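(* Let $(S^x_n)_{n\ge 0}$, $x\in\mathbb N_0^2$, be the identically reflected quadrant walk with data $(p,q)$ (as defined in the context), and let $Z_x$ be its number of boundary contacts. Let $\alpha_1$ and $\beta_{-1}$ be the unique solutions in $(0,1)$ of $$\alpha=\sum_{k,\ell}p_{k,\ell}\,\alpha^{k+1}\qquad\text{and}\qquad \beta=\sum_{k,\ell}p_{k,\ell}\,\beta^{\ell+1},$$ respectively, and let $\eta$ be a random variable with $\mathbf P(\eta=(k,\ell))=q_{k,\ell}$. Then for any $x=(i,j)\in\mathbb N_0^2$, as $n\to\infty$, $$\mathbf P(Z_x>n)\asymp \alpha_1^i\bigl(\mathbf E\,\alpha_1^{\Pi_1(\eta)}\bigr)^n+\beta_{-1}^j\bigl(\mathbf E\,\beta_{-1}^{\Pi_2(\eta)}\bigr)^n.$$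
   Context: $\mathbb N=\{1,2,\dots\}$, $\mathbb N_0=\{0,1,2,\dots\}$; $\Pi_1,\Pi_2$ denote the projections of $\mathbb R^2$ on the first and second coordinates. For real sequences, $a_n\asymp b_n$ as $n\to\infty$ means that there are constants $c_1,c_2>0$ with $c_1\le a_n/b_n\le c_2$ for all sufficiently large $n$. **Identically reflected quadrant walk with data $(p,q)$.** Let $\{p_{k,\ell}\}_{(k,\ell)\in\mathbb Z^2}$ and $\{q_{k,\ell}\}_{(k,\ell)\in\mathbb Z^2}$ be non-negative weights such that: (1) $\sum_{k,\ell}p_{k,\ell}=\sum_{k,\ell}q_{k,\ell}=1$; (2) $p_{k,\ell}=0$ whenever $k\le -2$ or $\ell\le -2$; (3) $p_{k,-1}\,p_{-1,\ell}>0$ for some $k,\ell$; (4) $\sum_{k,\ell}k\,p_{k,\ell}\in(0,\infty)$ and $\sum_{k,\ell}\ell\,p_{k,\ell}\in(0,\infty)$; (5) $q_{k,\ell}=0$ whenever $k\le -1$ or $\ell\le -1$; (6) $\sum_{k,\ell}k\,q_{k,\ell}\in(0,\infty)$ and $\sum_{k,\ell}\ell\,q_{k,\ell}\in(0,\infty)$. Let $(\xi_n)$ be i.i.d. with $\mathbf P(\xi_n=(k,\ell))=p_{k,\ell}$ and $(\eta_n)$ i.i.d. with $\mathbf P(\eta_n=(k,\ell))=q_{k,\ell}$, all independent. For $x\in\mathbb N_0^2$ set $S_0^x=x$ and $$S_{n+1}^x=S_n^x+\xi_{n+1}\mathbf 1_{\{S_n^x\in\mathbb N^2\}}+\eta_{n+1}\mathbf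 1_{\{S_n^x\in\mathbb N_0^2\setminus\mathbb N^2\}},\quad n\ge 0.$$ The number of boundary contacts is $Z_x=\sum_{n\ge 0}\mathbf 1_{\{S_n^x\in\mathbb N_0^2\setminus\mathbb N^2\}}$. *)

theory Defs
  imports "HOL-Probability.Probability"
begin

definition seq_asymp :: "(nat \<Rightarrow> real) \<Rightarrow> (nat \<Rightarrow> real) \<Rightarrow> bool"  (infix "\<asymp>" 50) where
  "a \<asymp> b \<longleftrightarrow> (\<exists>c1 c2. c1 > 0 \<and> c2 > 0 \<and>
     eventually (\<lambda>n. c1 \<le> a n / b n \<and> a n / b n \<le> c2) sequentially)"

definition quadrant :: "(int \<times> int) set" where
  "quadrant = {0..} \<times> {0..}"

definition quadrant_interior :: "(int \<times> int) set" where
  "quadrant_interior = {1..} \<times> {1..}"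

definition quadrant_boundary :: "(int \<times> int) set" where
  "quadrant_boundary = quadrant - quadrant_interior"

text \<open>The weights are given as probability mass functions, which makes them non-negative with
  total mass one.  For real series unconditional summability is absolute summability, so
  together with the support conditions \<open>summable_on\<close> says that the first moments are finite.\<close>

locale reflected_walk_data =
  fixes p q :: "(int \<times> int) pmf"
  assumes p_support: "\<And>k l. k \<le> -2 \<or> l \<le> -2 \<Longrightarrow> pmf p (k, l) = 0"
    and p_minus_one: "\<exists>k l. pmf p (k, -1) * pmf p (-1, l) > 0"
    and p_summable_fst: "(\<lambda>(k, l). real_of_int k * pmf p (k, l)) summable_on UNIV"
    and p_drift_fst: "(\<Sum>\<^sub>\<infinity>(k, l)\<in>UNIV. real_of_int k * pmf p (k, l)) > 0"
    and p_summable_snd: "(\<lambda>(k, l). real_of_int l * pmf p (k, l)) summable_on UNIV"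
    and p_drift_snd: "(\<Sum>\<^sub>\<infinity>(k, l)\<in>UNIV. real_of_int l * pmf p (k, l)) > 0"
    and q_support: "\<And>k l. k \<le> -1 \<or> l \<le> -1 \<Longrightarrow> pmf q (k, l) = 0"
    and q_summable_fst: "(\<lambda>(k, l). real_of_int k * pmf q (k, l)) summable_on UNIV"
    and q_drift_fst: "(\<Sum>\<^sub>\<infinity>(k, l)\<in>UNIV. real_of_int k * pmf q (k, l)) > 0"
    and q_summable_snd: "(\<lambda>(k, l). real_of_int l * pmf q (k, l)) summable_on UNIV"
    and q_drift_snd: "(\<Sum>\<^sub>\<infinity>(k, l)\<in>UNIV. real_of_int l * pmf q (k, l)) > 0"

text \<open>Time indices of the increments are shifted by one: \<open>\<xi> n\<close> and \<open>\<eta> n\<close> are the increments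
  available for the step from time \<open>n\<close> to time \<open>n + 1\<close>.  Independence is that of the joint
  family of all \<open>\<xi> n\<close> and all \<open>\<eta> n\<close>.\<close>

locale reflected_walk = prob_space M + reflected_walk_data p q
  for M :: "'w measure" and p q :: "(int \<times> int) pmf" +
  fixes \<xi> \<eta> :: "nat \<Rightarrow> 'w \<Rightarrow> int \<times> int"
  assumes \<xi>_distr: "\<And>n. distr M (count_space UNIV) (\<xi> n) = measure_pmf p"
    and \<eta>_distr: "\<And>n. distr M (count_space UNIV) (\<eta> n) = measure_pmf q"
    and indep: "indep_vars (\<lambda>_. count_space UNIV) (case_sum \<xi> \<eta>) UNIV"

primrec walk :: "(nat \<Rightarrow> 'w \<Rightarrow> int \<times> int) \<Rightarrow> (nat \<Rightarrow> 'w \<Rightarrow> int \<times> int) \<Rightarrow>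
    int \<times> int \<Rightarrow> nat \<Rightarrow> 'w \<Rightarrow> int \<times> int" where
  "walk \<xi> \<eta> x 0 \<omega> = x"
| "walk \<xi> \<eta> x (Suc n) \<omega> = walk \<xi> \<eta> x n \<omega>
     + (if walk \<xi> \<eta> x n \<omega> \<in> quadrant_interior then \<xi> n \<omega> else 0)
     + (if walk \<xi> \<eta> x n \<omega> \<in> quadrant_boundary then \<eta> n \<omega> else 0)"

definition boundary_contacts :: "(nat \<Rightarrow> 'w \<Rightarrow> int \<times> int) \<Rightarrow> (nat \<Rightarrow> 'w \<Rightarrow> int \<times> int) \<Rightarrow>
    int \<times> int \<Rightarrow> 'w \<Rightarrow> ennreal" where
  "boundary_contacts \<xi> \<eta> x \<omega> = (\<Sum>n. indicator quadrant_boundary (walk \<xi> \<eta> x n \<omega>))"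

definition alpha1 :: "(int \<times> int) pmf \<Rightarrow> real" where
  "alpha1 p = (THE \<alpha>. 0 < \<alpha> \<and> \<alpha> < 1 \<and>
     \<alpha> = (\<Sum>\<^sub>\<infinity>(k, l)\<in>UNIV. pmf p (k, l) * \<alpha> powi (k + 1)))"

definition beta_m1 :: "(int \<times> int) pmf \<Rightarrow> real" where
  "beta_m1 p = (THE \<beta>. 0 < \<beta> \<and> \<beta> < 1 \<and>
     \<beta> = (\<Sum>\<^sub>\<infinity>(k, l)\<in>UNIV. pmf p (k, l) * \<beta> powi (l + 1)))"

end

theory Submission imports Defs begin

text \<open>
  Put \<open>A = E \<alpha>\<^sub>1 ^ \<Pi>\<^sub>1 \<eta>\<close> and \<open>B = E \<beta> ^ \<Pi>\<^sub>2 \<eta>\<close>, and let \<open>N\<^sub>t\<close> count the contacts before time \<open>t\<close>.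
  Interior steps preserve \<open>\<alpha>\<^sub>1 ^ \<Pi>\<^sub>1 y\<close> in mean, and boundary steps multiply it by \<open>A\<close>; likewise
  for \<open>\<beta>\<close> and \<open>B\<close>. As one coordinate vanishes on the boundary, the process
  \<open>\<alpha>\<^sub>1 ^ \<Pi>\<^sub>1 S\<^sub>t * A ^ (n - N\<^sub>t) + \<beta> ^ \<Pi>\<^sub>2 S\<^sub>t * B ^ (n - N\<^sub>t)\<close>, replaced by \<open>1\<close> once \<open>N\<^sub>t > n\<close>,
  is a supermartingale dominating the indicator of \<open>N\<^sub>t > n\<close>. This gives the upper bound with constant 1.

  Conversely each single term, replaced by \<open>1\<close> once \<open>N\<^sub>t > n\<close>, is a submartingale. Its part
  on \<open>N\<^sub>t \<le> n\<close> vanishes in mean: choose \<open>s\<close> between \<open>\<alpha>\<^sub>1\<close> and \<open>1\<close> with \<open>E s ^ \<Pi>\<^sub>1 \<xi> < r < 1\<close>; then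
  \<open>s ^ \<Pi>\<^sub>1 S\<^sub>t * r ^ N\<^sub>t\<close> contracts by the factor \<open>r\<close> in every step, and on \<open>N\<^sub>t \<le> n\<close> it dominates
  the term up to the constant \<open>r ^ n\<close>. So the probability is at least each of the two terms, hence
  at least half their sum.
\<close>

section \<open>Unordered sums against a pmf as integrals\<close>

lemma integrable_measure_pmf_iff_summable_on:
  fixes f :: "'a \<Rightarrow> real"
  shows "integrable (measure_pmf p) f \<longleftrightarrow> (\<lambda>x. f x * pmf p x) summable_on UNIV"
proof -
  have "integrable (measure_pmf p) f \<longleftrightarrow> integrable (count_space UNIV) (\<lambda>x. pmf p x * f x)"
    unfolding measure_pmf_eq_density by (subst integrable_density) simp_all
  also have "\<dots> \<longleftrightarrow> Infinite_Set_Sum.abs_summable_on (\<lambda>x. pmf p x * f x) UNIV"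
    by (simp add: Infinite_Set_Sum.abs_summable_on_def)
  also have "\<dots> \<longleftrightarrow> (\<lambda>x. f x * pmf p x) summable_on UNIV"
    by (subst abs_summable_equivalent[symmetric], subst summable_on_iff_abs_summable_on_real[symmetric])
      (simp add: mult.commute)
  finally show ?thesis .
qed

text \<open>The drifts and the equations for \<open>alpha1\<close> and \<open>beta_m1\<close> are
  unordered sums; this carries them over to expectations, where convergence theorems apply.\<close>

lemma expectation_measure_pmf_eq_infsum:
  fixes f :: "'a \<Rightarrow> real"
  shows "measure_pmf.expectation p f = (\<Sum>\<^sub>\<infinity>x. f x * pmf p x)"
proof (cases "integrable (measure_pmf p) f")
  case True
  then have "Infinite_Set_Sum.abs_summable_on (\<lambda>x. pmf p x * f x) UNIV"
    unfolding integrable_measure_pmf_iff_summable_on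
    by (subst abs_summable_equivalent[symmetric], subst summable_on_iff_abs_summable_on_real[symmetric])
      (simp add: mult.commute)
  from infsetsum_infsum[OF this] show ?thesis
    unfolding pmf_expectation_eq_infsetsum by (simp add: mult.commute)
next
  \<comment> \<open>Without integrability both sides take the default value 0.\<close>
  case False
  then show ?thesis
    using integrable_measure_pmf_iff_summable_on[of p f]
    by (simp add: not_integrable_integral_eq infsum_not_exists)
qed

section \<open>Convexity and fixed points of probability generating functions\<close>

lemma integrable_power_pmf:
  fixes s :: real
  assumes "0 \<le> s" "s \<le> 1"
  shows "integrable (measure_pmf P) (\<lambda>x. s ^ N x)"
  by (rule measure_pmf.integrable_const_bound[where B = 1])
    (use assms in \<open>auto simp: power_le_one\<close>)

text \<open>Each power is convex on the nonnegative half-line, and averaging over \<open>P\<close>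
  keeps convexity. On \<open>{0..1}\<close> the powers are bounded by 1, so all expectations are
  finite.\<close>

lemma convex_on_expectation_power:
  "convex_on {0..1} (\<lambda>s::real. measure_pmf.expectation P (\<lambda>x. s ^ N x))"
proof (rule convex_onI)
  fix t x y :: real
  assume t: "0 < t" "t < 1" and xy: "x \<in> {0..1}" "y \<in> {0..1}"
  define z where "z = (1 - t) *\<^sub>R x + t *\<^sub>R y"
  have z: "z \<in> {0..1}" unfolding z_def
    by (rule convexD) (use t xy in auto)
  have cv: "z ^ n \<le> (1 - t) * x ^ n + t * y ^ n" for n
  proof -
    have "convex_on {0..} (\<lambda>x::real. x ^ n)"
      by (cases "even n") (auto intro: convex_power_odd convex_on_subset[OF convex_power_even])
    from convex_onD[OF this, of t x y] show ?thesis unfolding z_def using t xy by simp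
  qed
  have "measure_pmf.expectation P (\<lambda>w. z ^ N w) \<le>
      measure_pmf.expectation P (\<lambda>w. (1 - t) * x ^ N w + t * y ^ N w)"
    by (intro integral_mono Bochner_Integration.integrable_add integrable_mult_right integrable_power_pmf cv)
      (use z xy in auto)
  also have "\<dots> = (1 - t) * measure_pmf.expectation P (\<lambda>w. x ^ N w)
      + t * measure_pmf.expectation P (\<lambda>w. y ^ N w)"
    using xy by (subst Bochner_Integration.integral_add) (simp_all add: integrable_power_pmf)
  finally show "measure_pmf.expectation P (\<lambda>w. ((1 - t) *\<^sub>R x + t *\<^sub>R y) ^ N w) \<le>
      (1 - t) * measure_pmf.expectation P (\<lambda>w. x ^ N w)
      + t * measure_pmf.expectation P (\<lambda>w. y ^ N w)" unfolding z_def .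
qed simp

text \<open>The difference quotients \<open>(1 - E s ^ N) / (1 - s)\<close> converge to \<open>E N > 1\<close> as \<open>s\<close> increases
  to \<open>1\<close>.\<close>

lemma expectation_power_less_self:
  fixes N :: "'a \<Rightarrow> nat"
  assumes int: "integrable (measure_pmf P) (\<lambda>x. real (N x))"
    and mean: "measure_pmf.expectation P (\<lambda>x. real (N x)) > 1"
  obtains s :: real where "0 < s" "s < 1" "measure_pmf.expectation P (\<lambda>x. s ^ N x) < s"
proof -
  define s where "s n = 1 - 1 / real (n + 2)" for n
  have s: "0 < s n" "s n < 1" for n unfolding s_def by (auto simp: field_simps)
  have slim: "s \<longlonglongrightarrow> 1 - 0" unfolding s_def
    by (rule tendsto_diff[OF tendsto_const LIMSEQ_ignore_initial_segment[OF lim_1_over_n]])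
  \<comment> \<open>As a finite geometric sum the quotient lies between 0 and \<open>m\<close>, so
    \<open>N x\<close> serves as the dominating function.\<close>
  have geo: "(1 - s n ^ m) / (1 - s n) = (\<Sum>k<m. s n ^ k)" for n m
    using s[of n] by (simp add: sum_gp_strict)
  have "(\<lambda>n. measure_pmf.expectation P (\<lambda>x. \<Sum>k<N x. s n ^ k))
      \<longlonglongrightarrow> measure_pmf.expectation P (\<lambda>x. real (N x))"
  proof (rule integral_dominated_convergence[where w = "\<lambda>x. real (N x)"])
    show "AE x in measure_pmf P. (\<lambda>n. \<Sum>k<N x. s n ^ k) \<longlonglongrightarrow> real (N x)"
    proof (rule AE_I2)
      fix x
      have "(\<lambda>n. \<Sum>k<N x. s n ^ k) \<longlonglongrightarrow> (\<Sum>k<N x. (1 - 0) ^ k)"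
        by (intro tendsto_intros slim)
      then show "(\<lambda>n. \<Sum>k<N x. s n ^ k) \<longlonglongrightarrow> real (N x)" by simp
    qed
    show "AE x in measure_pmf P. norm (\<Sum>k<N x. s n ^ k) \<le> real (N x)" for n
    proof (rule AE_I2)
      fix x
      have "(\<Sum>k<N x. s n ^ k) \<le> (\<Sum>k<N x. 1)"
        using s[of n] by (intro sum_mono) (auto intro: power_le_one less_imp_le)
      moreover have "0 \<le> (\<Sum>k<N x. s n ^ k)"
        using s[of n] by (intro sum_nonneg) auto
      ultimately show "norm (\<Sum>k<N x. s n ^ k) \<le> real (N x)" by simp
    qed
  qed (use int in auto)
  from order_tendstoD(1)[OF this mean]
  obtain n where n: "1 < measure_pmf.expectation P (\<lambda>x. \<Sum>k<N x. s n ^ k)"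
    by (meson eventually_sequentially order_refl)
  have "measure_pmf.expectation P (\<lambda>x. \<Sum>k<N x. s n ^ k)
      = (1 - measure_pmf.expectation P (\<lambda>x. s n ^ N x)) / (1 - s n)"
    unfolding geo[symmetric]
    by (simp add: integrable_power_pmf s less_imp_le)
  with n s[of n] have "measure_pmf.expectation P (\<lambda>x. s n ^ N x) < s n"
    by (simp add: field_simps)
  with s show ?thesis by (rule that)
qed

text \<open>The convex function \<open>h s = E s ^ N - s\<close> is positive near 0 because
  \<open>N = 0\<close> has positive mass, negative at some \<open>s < 1\<close> because
  \<open>E N > 1\<close>, and zero at 1. The sign change gives a root, and convexity leaves room for
  only one in (0,1).\<close>

lemma expectation_power_fixed_point:
  fixes N :: "'a \<Rightarrow> nat"
  assumes int: "integrable (measure_pmf P) (\<lambda>x. real (N x))"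
    and mean: "measure_pmf.expectation P (\<lambda>x. real (N x)) > 1"
    and zero: "x0 \<in> set_pmf P" "N x0 = 0"
  obtains a s :: real where "0 < a" "a < s" "s < 1"
    "measure_pmf.expectation P (\<lambda>x. a ^ N x) = a"
    "measure_pmf.expectation P (\<lambda>x. s ^ N x) < s"
    "\<And>b. \<lbrakk>0 < b; b < 1; measure_pmf.expectation P (\<lambda>x. b ^ N x) = b\<rbrakk> \<Longrightarrow> b = a"
proof -
  define h where "h s = measure_pmf.expectation P (\<lambda>x. s ^ N x) - s" for s :: real
  have cvx: "convex_on {0..1} h" unfolding h_def
    by (intro convex_on_diff convex_on_expectation_power) (simp add: concave_on_ident)
  have conv: "h ((1 - t) * x + t * y) \<le> (1 - t) * h x + t * h y"
    if "0 \<le> t" "t \<le> 1" "x \<in> {0..1}" "y \<in> {0..1}" for t x y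
    using convex_onD[OF cvx that] by simp
  obtain s where s: "0 < s" "s < 1" "h s < 0"
    by (rule expectation_power_less_self[OF int mean]) (simp add: h_def)
  have pos: "pmf P x0 > 0" using zero(1) by (simp add: pmf_positive)
  \<comment> \<open>The atom at \<open>x0\<close> alone contributes \<open>pmf P x0\<close> to
    \<open>E e ^ N\<close>, so any \<open>e\<close> below that mass has
    \<open>h e > 0\<close>.\<close>
  define e where "e = min (s / 2) (pmf P x0 / 2)"
  have e: "0 < e" "e < s" "e < pmf P x0" using s pos unfolding e_def by auto
  have "pmf P x0 = measure_pmf.expectation P (indicator {x0})"
    by (simp add: pmf.rep_eq)
  also have "\<dots> \<le> measure_pmf.expectation P (\<lambda>x. e ^ N x)"
    by (intro integral_mono integrable_power_pmf integrable_real_indicator)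
      (use e s zero in \<open>auto simp: indicator_def measure_pmf.emeasure_eq_measure\<close>)
  finally have he: "h e > 0" using e unfolding h_def by simp
  \<comment> \<open>Convexity gives continuity only on the open interval, which contains
    \<open>{e..s}\<close>.\<close>
  have "continuous_on {0<..<1} h"
    by (rule convex_on_continuous) (auto intro: convex_on_subset[OF cvx])
  then have "continuous_on {e..s} h" by (rule continuous_on_subset) (use e s in auto)
  then obtain a where a: "e \<le> a" "a \<le> s" "h a = 0"
    using IVT2'[of h s 0 e] he s e by auto
  have "a < s" using a s by (cases "a = s") auto
  have h1: "h 1 = 0" unfolding h_def by simp
  have between: "h y < 0" if "x \<in> {0..1}" "z \<in> {0..1}" "h x < 0" "h z \<le> 0"
      "y \<in> open_segment x z" for x y z
  proof -
    from that(5) obtain t where t: "0 < t" "t < 1" "y = (1 - t) * x + t * z"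
      by (auto simp: in_segment)
    have "h y \<le> (1 - t) * h x + t * h z" using conv[of t x z] t that by simp
    moreover have "(1 - t) * h x < 0" using t that by (simp add: mult_pos_neg)
    moreover have "t * h z \<le> 0" using t that by (simp add: mult_nonneg_nonpos)
    ultimately show ?thesis by linarith
  qed
  \<comment> \<open>A root beyond \<open>s\<close> would lie strictly between \<open>s\<close> and
    1, where \<open>between\<close> makes \<open>h\<close> negative.\<close>
  have root_less: "b < s" if "0 < b" "b < 1" "h b = 0" for b
  proof (rule ccontr)
    assume "\<not> b < s"
    then have "b \<in> open_segment s 1" using that s
      by (cases "b = s") (auto simp: open_segment_eq_real_ivl)
    from between[OF _ _ s(3) _ this] s h1 that show False by auto
  qed
  \<comment> \<open>The larger of two roots left of \<open>s\<close> would lie strictly between the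
    smaller one and \<open>s\<close>, where \<open>h\<close> is again negative.\<close>
  have no_two: "\<not> b < c" if "0 < b" "h b = 0" "0 < c" "c < s" "h c = 0" for b c
  proof
    assume "b < c"
    then have "c \<in> open_segment s b" using that s by (auto simp: open_segment_eq_real_ivl)
    from between[OF _ _ s(3) _ this] s \<open>b < c\<close> that show False by auto
  qed
  show ?thesis
  proof (rule that)
    show "0 < a" "a < s" "s < 1" using e a s \<open>a < s\<close> by auto
    show "measure_pmf.expectation P (\<lambda>x. a ^ N x) = a"
      "measure_pmf.expectation P (\<lambda>x. s ^ N x) < s"
      using a s unfolding h_def by auto
    fix b :: real
    assume b: "0 < b" "b < 1" "measure_pmf.expectation P (\<lambda>x. b ^ N x) = b"
    then have hb: "h b = 0" unfolding h_def by simp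
    have "0 < a" using a e by simp
    have "b < s" by (rule root_less[OF b(1,2) hb])
    show "b = a"
      using no_two[OF \<open>0 < a\<close> a(3) b(1) \<open>b < s\<close> hb] no_two[OF b(1) hb \<open>0 < a\<close> \<open>a < s\<close> a(3)] by simp
  qed
qed

text \<open>On the support \<open>\<pi> + 1\<close> is a natural number \<open>N\<close> with mean
  above 1, and dividing \<open>E b ^ N\<close> by \<open>b\<close> gives
  \<open>E b powi \<pi>\<close>. The fixed point thus becomes expectation 1, the point below the
  diagonal an expectation under 1, and uniqueness resolves the \<open>THE\<close>.\<close>

lemma pgf_root_of_drift:
  fixes p :: "'a pmf" and \<pi> :: "'a \<Rightarrow> int"
  assumes supp: "\<And>x. x \<in> set_pmf p \<Longrightarrow> -1 \<le> \<pi> x"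
    and low: "x0 \<in> set_pmf p" "\<pi> x0 = -1"
    and int: "integrable (measure_pmf p) (\<lambda>x. real_of_int (\<pi> x))"
    and drift: "measure_pmf.expectation p (\<lambda>x. real_of_int (\<pi> x)) > 0"
    and a_def: "a = (THE a. 0 < a \<and> a < 1 \<and>
      a = (\<Sum>\<^sub>\<infinity>x. pmf p x * a powi (\<pi> x + 1)))"
  obtains s :: real where "0 < a" "a < s" "s < 1"
    "(\<integral>\<^sup>+x. ennreal (a powi \<pi> x) \<partial>p) = 1" "(\<integral>\<^sup>+x. ennreal (s powi \<pi> x) \<partial>p) < 1"
proof -
  define N where "N x = nat (\<pi> x + 1)" for x
  have N: "real (N x) = real_of_int (\<pi> x) + 1" if "x \<in> set_pmf p" for x
    using supp[OF that] by (simp add: N_def)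
  have iN: "integrable (measure_pmf p) (\<lambda>x. real (N x)) \<longleftrightarrow>
      integrable (measure_pmf p) (\<lambda>x. real_of_int (\<pi> x) + 1)"
    by (intro integrable_cong_AE) (auto simp: AE_measure_pmf_iff N)
  have "measure_pmf.expectation p (\<lambda>x. real (N x)) =
      measure_pmf.expectation p (\<lambda>x. real_of_int (\<pi> x) + 1)"
    by (intro integral_cong_AE) (auto simp: AE_measure_pmf_iff N)
  then have mean: "measure_pmf.expectation p (\<lambda>x. real (N x)) > 1"
    using int drift by simp
  obtain c s :: real where cs: "0 < c" "c < s" "s < 1"
    "measure_pmf.expectation p (\<lambda>x. c ^ N x) = c"
    "measure_pmf.expectation p (\<lambda>x. s ^ N x) < s"
    "\<And>b. \<lbrakk>0 < b; b < 1; measure_pmf.expectation p (\<lambda>x. b ^ N x) = b\<rbrakk> \<Longrightarrow> b = c"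
  proof (rule expectation_power_fixed_point[OF _ mean low(1)])
    show "integrable (measure_pmf p) (\<lambda>x. real (N x))" unfolding iN using int by simp
    show "N x0 = 0" using low by (simp add: N_def)
  qed (rule that)
  have pw: "b powi (\<pi> x + 1) = b ^ N x" if "x \<in> set_pmf p" for b :: real and x
    using supp[OF that] by (simp add: N_def power_int_def)
  have "(\<Sum>\<^sub>\<infinity>x. pmf p x * b powi (\<pi> x + 1)) = measure_pmf.expectation p (\<lambda>x. b ^ N x)" for b
  proof -
    have "(\<Sum>\<^sub>\<infinity>x. pmf p x * b powi (\<pi> x + 1)) = (\<Sum>\<^sub>\<infinity>x. b ^ N x * pmf p x)"
    proof (rule infsum_cong)
      \<comment> \<open>Off the support the mass is 0, so the truncation in \<open>N\<close> is
        harmless.\<close>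
      show "pmf p x * b powi (\<pi> x + 1) = b ^ N x * pmf p x" for x
        by (cases "x \<in> set_pmf p") (simp_all add: pw set_pmf_iff)
    qed
    then show ?thesis by (simp add: expectation_measure_pmf_eq_infsum)
  qed
  then have "a = (THE a. 0 < a \<and> a < 1 \<and> a = measure_pmf.expectation p (\<lambda>x. a ^ N x))"
    unfolding a_def by simp
  also have "\<dots> = c"
  proof (rule the_equality)
    show "0 < c \<and> c < 1 \<and> c = measure_pmf.expectation p (\<lambda>x. c ^ N x)"
      using cs(1-3) cs(4)[symmetric] by simp
    show "b = c" if "0 < b \<and> b < 1 \<and> b = measure_pmf.expectation p (\<lambda>x. b ^ N x)" for b
      using that by (metis cs(6))
  qed
  finally have ac: "a = c" .
  have nn: "(\<integral>\<^sup>+x. ennreal (b powi \<pi> x) \<partial>p) =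
      ennreal (measure_pmf.expectation p (\<lambda>x. b ^ N x) / b)" if b: "0 < b" "b < 1" for b :: real
  proof -
    have "b powi \<pi> x = b ^ N x / b" if "x \<in> set_pmf p" for x
      unfolding pw[OF that, symmetric] using b by (simp add: power_int_add)
    then have "(\<integral>\<^sup>+x. ennreal (b powi \<pi> x) \<partial>p) = (\<integral>\<^sup>+x. ennreal (b ^ N x / b) \<partial>p)"
      by (intro nn_integral_cong_AE) (simp add: AE_measure_pmf_iff)
    also have "\<dots> = ennreal (measure_pmf.expectation p (\<lambda>x. b ^ N x / b))"
      using b by (intro nn_integral_eq_integral integrable_divide integrable_power_pmf) simp_all
    finally show ?thesis by simp
  qed
  show ?thesis
  proof (rule that)
    show "(\<integral>\<^sup>+x. ennreal (a powi \<pi> x) \<partial>p) = 1" using nn[of c] cs(1-4) ac by simp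
    show "(\<integral>\<^sup>+x. ennreal (s powi \<pi> x) \<partial>p) < 1" using nn[of s] cs(1-3,5)
      by simp
  qed (use cs(1-3) ac in auto)
qed

section \<open>Independence, and the walk with its contact counter as a Markov chain\<close>

lemma (in prob_space) nn_integral_indep_var:
  assumes ind: "indep_var S U T V" and h[measurable]: "h \<in> borel_measurable (S \<Otimes>\<^sub>M T)"
  shows "(\<integral>\<^sup>+\<omega>. h (U \<omega>, V \<omega>) \<partial>M) = (\<integral>\<^sup>+\<omega>. \<integral>\<^sup>+\<omega>'. h (U \<omega>, V \<omega>') \<partial>M \<partial>M)"
proof -
  have U[measurable]: "U \<in> measurable M S" and V[measurable]: "V \<in> measurable M T"
    using ind by (auto dest: indep_var_rv1 indep_var_rv2)
  interpret V: prob_space "distr M T V" by (rule prob_space_distr) fact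
  have "(\<integral>\<^sup>+\<omega>. h (U \<omega>, V \<omega>) \<partial>M) = (\<integral>\<^sup>+z. h z \<partial>distr M (S \<Otimes>\<^sub>M T) (\<lambda>\<omega>. (U \<omega>, V \<omega>)))"
    by (subst nn_integral_distr) simp_all
  also have "\<dots> = (\<integral>\<^sup>+z. h z \<partial>(distr M S U \<Otimes>\<^sub>M distr M T V))"
    using ind unfolding indep_var_distribution_eq by simp
  also have "\<dots> = (\<integral>\<^sup>+u. \<integral>\<^sup>+v. h (u, v) \<partial>distr M T V \<partial>distr M S U)"
    by (rule V.nn_integral_fst[symmetric]) simp
  also have "\<dots> = (\<integral>\<^sup>+\<omega>. \<integral>\<^sup>+v. h (U \<omega>, v) \<partial>distr M T V \<partial>M)"
    by (subst nn_integral_distr) simp_all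
  also have "\<dots> = (\<integral>\<^sup>+\<omega>. \<integral>\<^sup>+\<omega>'. h (U \<omega>, V \<omega>') \<partial>M \<partial>M)"
  proof (rule nn_integral_cong)
    fix \<omega> assume "\<omega> \<in> space M"
    then have "U \<omega> \<in> space S" by (rule measurable_space[OF U])
    then show "(\<integral>\<^sup>+v. h (U \<omega>, v) \<partial>distr M T V) = (\<integral>\<^sup>+\<omega>'. h (U \<omega>, V \<omega>') \<partial>M)"
      by (subst nn_integral_distr) simp_all
  qed
  finally show ?thesis .
qed

text \<open>Time \<open>t\<close> itself is left out, so a contact is counted together with the
  reflected step that leaves it.\<close>

definition contacts :: "(nat \<Rightarrow> 'w \<Rightarrow> int \<times> int) \<Rightarrow> (nat \<Rightarrow> 'w \<Rightarrow> int \<times> int) \<Rightarrow>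
    int \<times> int \<Rightarrow> nat \<Rightarrow> 'w \<Rightarrow> nat" where
  "contacts \<xi> \<eta> x t \<omega> = (\<Sum>m<t. of_bool (walk \<xi> \<eta> x m \<omega> \<in> quadrant_boundary))"

definition state :: "(nat \<Rightarrow> 'w \<Rightarrow> int \<times> int) \<Rightarrow> (nat \<Rightarrow> 'w \<Rightarrow> int \<times> int) \<Rightarrow>
    int \<times> int \<Rightarrow> nat \<Rightarrow> 'w \<Rightarrow> (int \<times> int) \<times> nat" where
  "state \<xi> \<eta> x t \<omega> = (walk \<xi> \<eta> x t \<omega>, contacts \<xi> \<eta> x t \<omega>)"

lemma boundary_not_interior: "y \<in> quadrant_boundary \<Longrightarrow> y \<notin> quadrant_interior"
  by (simp add: quadrant_boundary_def)

lemma state_0: "state \<xi> \<eta> x 0 \<omega> = (x, 0)"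
  by (simp add: state_def contacts_def)

lemma state_Suc:
  "state \<xi> \<eta> x (Suc t) \<omega> = (case state \<xi> \<eta> x t \<omega> of (y, m) \<Rightarrow>
     if y \<in> quadrant_interior then (y + \<xi> t \<omega>, m)
     else if y \<in> quadrant_boundary then (y + \<eta> t \<omega>, Suc m) else (y, m))"
  by (auto simp: state_def contacts_def dest: boundary_not_interior)

text \<open>Stated for arbitrary increments, with assumptions only before time \<open>t\<close>, so
  that it also applies to the coordinate maps of a product space.\<close>

lemma measurable_state:
  assumes "\<And>m. m < t \<Longrightarrow> \<xi> m \<in> measurable M (count_space UNIV)"
    and "\<And>m. m < t \<Longrightarrow> \<eta> m \<in> measurable M (count_space UNIV)"
  shows "state \<xi> \<eta> x t \<in> measurable M (count_space UNIV)"
  using assms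
proof (induction t)
  case 0
  then show ?case by (simp add: state_0[abs_def])
next
  case (Suc t)
  have Y: "state \<xi> \<eta> x t \<in> measurable M (count_space UNIV)"
    and xi: "\<xi> t \<in> measurable M (count_space UNIV)"
    and eta: "\<eta> t \<in> measurable M (count_space UNIV)"
    using Suc by simp_all
  have "(\<lambda>\<omega>. case state \<xi> \<eta> x t \<omega> of (y, m) \<Rightarrow>
     if y \<in> quadrant_interior then (y + \<xi> t \<omega>, m)
     else if y \<in> quadrant_boundary then (y + \<eta> t \<omega>, Suc m) else (y, m))
     \<in> measurable M (count_space UNIV)"
  proof (rule measurable_compose_countable[OF _ Y, of "\<lambda>z \<omega>. case z of (y, m) \<Rightarrow>
     if y \<in> quadrant_interior then (y + \<xi> t \<omega>, m)
     else if y \<in> quadrant_boundary then (y + \<eta> t \<omega>, Suc m) else (y, m)"])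
    fix z :: "(int \<times> int) \<times> nat"
    obtain y m where z: "z = (y, m)" by (cases z)
    have "(\<lambda>\<omega>. (y + \<xi> t \<omega>, m)) \<in> measurable M (count_space UNIV)"
      "(\<lambda>\<omega>. (y + \<eta> t \<omega>, Suc m)) \<in> measurable M (count_space UNIV)"
      using measurable_compose[OF xi measurable_count_space, of "\<lambda>k. (y + k, m)"]
        measurable_compose[OF eta measurable_count_space, of "\<lambda>k. (y + k, Suc m)"] by simp_all
    then show "(\<lambda>\<omega>. case z of (y, m) \<Rightarrow>
     if y \<in> quadrant_interior then (y + \<xi> t \<omega>, m)
     else if y \<in> quadrant_boundary then (y + \<eta> t \<omega>, Suc m) else (y, m))
     \<in> measurable M (count_space UNIV)"
      by (simp add: z)
  qed
  then show ?case by (simp add: state_Suc[abs_def])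
qed

text \<open>Only increments before \<open>t\<close> enter. Two sample points and two families are
  allowed so that the state can be recomputed on a product space.\<close>

lemma state_cong:
  assumes "\<And>m. m < t \<Longrightarrow> \<xi> m \<omega> = \<xi>' m \<omega>'" "\<And>m. m < t \<Longrightarrow> \<eta> m \<omega> = \<eta>' m \<omega>'"
  shows "state \<xi> \<eta> x t \<omega> = state \<xi>' \<eta>' x t \<omega>'"
  using assms by (induction t) (simp_all add: state_0 state_Suc split: prod.split)

text \<open>The one-step Markov operator of the chain \<open>state\<close>; outside the quadrant the
  chain is frozen, as \<open>walk\<close> is.\<close>

definition transition :: "(int \<times> int) pmf \<Rightarrow> (int \<times> int) pmf \<Rightarrow>
    ((int \<times> int) \<times> nat \<Rightarrow> ennreal) \<Rightarrow> (int \<times> int) \<times> nat \<Rightarrow> ennreal" where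
  "transition p q F = (\<lambda>(y, m).
     if y \<in> quadrant_interior then \<integral>\<^sup>+k. F (y + k, m) \<partial>p
     else if y \<in> quadrant_boundary then \<integral>\<^sup>+k. F (y + k, Suc m) \<partial>q
     else F (y, m))"

context reflected_walk
begin

lemma \<xi>_measurable: "\<xi> n \<in> measurable M (count_space UNIV)"
  and \<eta>_measurable: "\<eta> n \<in> measurable M (count_space UNIV)"
proof -
  have "case_sum \<xi> \<eta> i \<in> measurable M (count_space UNIV)" for i
    using indep by (auto simp: indep_vars_def)
  from this[of "Inl n"] this[of "Inr n"]
  show "\<xi> n \<in> measurable M (count_space UNIV)" "\<eta> n \<in> measurable M (count_space UNIV)"
    by simp_all
qed

lemma state_measurable [measurable]: "state \<xi> \<eta> x t \<in> measurable M (count_space UNIV)"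
  by (intro measurable_state \<xi>_measurable \<eta>_measurable)

text \<open>The state at time \<open>t\<close> is a function of the increments before
  \<open>t\<close>, hence independent of any other increment. Indexing by the sum type treats
  \<open>\<xi> t\<close> and \<open>\<eta> t\<close> at once.\<close>

lemma nn_integral_state_increment:
  assumes "i \<notin> Inl ` {..<t} \<union> Inr ` {..<t}"
  shows "(\<integral>\<^sup>+\<omega>. F (state \<xi> \<eta> x t \<omega>) (case_sum \<xi> \<eta> i \<omega>) \<partial>M) =
    (\<integral>\<^sup>+\<omega>. \<integral>\<^sup>+k. F (state \<xi> \<eta> x t \<omega>) k \<partial>distr M (count_space UNIV) (case_sum \<xi> \<eta> i) \<partial>M)"
proof -
  define J where "J = (Inl ` {..<t} \<union> Inr ` {..<t} :: (nat + nat) set)"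
  let ?P = "\<lambda>J. Pi\<^sub>M J (\<lambda>_. count_space UNIV :: (int \<times> int) measure)"
  \<comment> \<open>\<open>f\<close> rebuilds the state from the restricted family, which exhibits
    it as a function of the coordinates in \<open>J\<close>.\<close>
  define f where "f = state (\<lambda>m w. w (Inl m)) (\<lambda>m w. w (Inr m)) x t"
  have ind: "indep_var (?P J) (\<lambda>\<omega>. \<lambda>i\<in>J. case_sum \<xi> \<eta> i \<omega>)
      (?P {i}) (\<lambda>\<omega>. \<lambda>i\<in>{i}. case_sum \<xi> \<eta> i \<omega>)"
    by (rule indep_var_restrict[OF indep]) (use assms in \<open>auto simp: J_def\<close>)
  have f: "f \<in> measurable (?P J) (count_space UNIV)"
    unfolding f_def by (rule measurable_state) (auto simp: J_def intro!: measurable_component_singleton)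
  have fst: "(\<lambda>z. f (fst z)) \<in> measurable (?P J \<Otimes>\<^sub>M ?P {i}) (count_space UNIV)"
    by (rule measurable_compose[OF measurable_fst f])
  have snd: "(\<lambda>z. snd z i) \<in> measurable (?P J \<Otimes>\<^sub>M ?P {i}) (count_space UNIV)"
    by (rule measurable_compose[OF measurable_snd]) (rule measurable_component_singleton, simp)
  \<comment> \<open>The state space is countable, so an arbitrary \<open>F\<close> is jointly
    measurable.\<close>
  have meas: "(\<lambda>z. F (f (fst z)) (snd z i)) \<in> borel_measurable (?P J \<Otimes>\<^sub>M ?P {i})"
    by (rule measurable_compose_countable[OF _ fst], rule measurable_compose[OF snd]) simp
  have f_eq: "f (\<lambda>i\<in>J. case_sum \<xi> \<eta> i \<omega>) = state \<xi> \<eta> x t \<omega>" for \<omega>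
    unfolding f_def by (rule state_cong) (auto simp: J_def)
  have incr: "case_sum \<xi> \<eta> i \<in> measurable M (count_space UNIV)"
    using indep by (auto simp: indep_vars_def)
  show ?thesis
    using nn_integral_indep_var[OF ind meas] incr by (simp add: f_eq nn_integral_distr)
qed

text \<open>The integrand is split by position into interior, boundary and outside. Each piece
  involves at most one fresh increment, so independence applies to the pieces separately.\<close>

lemma nn_integral_state_Suc:
  "(\<integral>\<^sup>+\<omega>. F (state \<xi> \<eta> x (Suc t) \<omega>) \<partial>M) = (\<integral>\<^sup>+\<omega>. transition p q F (state \<xi> \<eta> x t \<omega>) \<partial>M)"
proof -
  let ?Y = "state \<xi> \<eta> x t"
  let ?I = "\<lambda>z. fst z \<in> quadrant_interior" and ?B = "\<lambda>z. fst z \<in> quadrant_boundary"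
  define G where "G z k = (if ?I z then F (fst z + k, snd z) else 0)" for z k
  define H where "H z k = (if ?B z then F (fst z + k, Suc (snd z)) else 0)" for z k
  define K where "K z = (if \<not> ?I z \<and> \<not> ?B z then F z else 0)" for z
  have G: "(\<integral>\<^sup>+\<omega>. G (?Y \<omega>) (\<xi> t \<omega>) \<partial>M) = (\<integral>\<^sup>+\<omega>. \<integral>\<^sup>+k. G (?Y \<omega>) k \<partial>p \<partial>M)"
    using nn_integral_state_increment[of "Inl t" t G x]
    by (auto simp: \<xi>_distr)
  have H: "(\<integral>\<^sup>+\<omega>. H (?Y \<omega>) (\<eta> t \<omega>) \<partial>M) = (\<integral>\<^sup>+\<omega>. \<integral>\<^sup>+k. H (?Y \<omega>) k \<partial>q \<partial>M)"
    using nn_integral_state_increment[of "Inr t" t H x]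
    by (auto simp: \<eta>_distr)
  have trans: "(\<integral>\<^sup>+k. G z k \<partial>p) + ((\<integral>\<^sup>+k. H z k \<partial>q) + K z) = transition p q F z" for z
    using boundary_not_interior[of "fst z"]
    by (cases "?I z"; cases "?B z") (simp_all add: transition_def G_def H_def K_def split_beta)
  have meas: "(\<lambda>\<omega>. f (?Y \<omega>)) \<in> borel_measurable M" for f :: "_ \<Rightarrow> ennreal"
    by (rule measurable_compose[OF state_measurable]) simp
  have measG: "(\<lambda>\<omega>. G (?Y \<omega>) (\<xi> t \<omega>)) \<in> borel_measurable M"
    by (rule measurable_compose_countable[OF _ state_measurable])
      (rule measurable_compose[OF \<xi>_measurable], simp)
  have measH: "(\<lambda>\<omega>. H (?Y \<omega>) (\<eta> t \<omega>)) \<in> borel_measurable M"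
    by (rule measurable_compose_countable[OF _ state_measurable])
      (rule measurable_compose[OF \<eta>_measurable], simp)
  have "(\<integral>\<^sup>+\<omega>. F (state \<xi> \<eta> x (Suc t) \<omega>) \<partial>M) =
      (\<integral>\<^sup>+\<omega>. G (?Y \<omega>) (\<xi> t \<omega>) + (H (?Y \<omega>) (\<eta> t \<omega>) + K (?Y \<omega>)) \<partial>M)"
    by (intro nn_integral_cong)
      (auto simp: state_Suc G_def H_def K_def split: prod.split dest: boundary_not_interior)
  also have "\<dots> = (\<integral>\<^sup>+\<omega>. G (?Y \<omega>) (\<xi> t \<omega>) \<partial>M) + ((\<integral>\<^sup>+\<omega>. H (?Y \<omega>) (\<eta> t \<omega>) \<partial>M) + (\<integral>\<^sup>+\<omega>. K (?Y \<omega>) \<partial>M))"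
    using measG measH meas[of K] by (simp add: nn_integral_add)
  also have "\<dots> = (\<integral>\<^sup>+\<omega>. (\<integral>\<^sup>+k. G (?Y \<omega>) k \<partial>p) + ((\<integral>\<^sup>+k. H (?Y \<omega>) k \<partial>q) + K (?Y \<omega>)) \<partial>M)"
    unfolding G H
    using meas[of "\<lambda>z. \<integral>\<^sup>+k. G z k \<partial>p"] meas[of "\<lambda>z. \<integral>\<^sup>+k. H z k \<partial>q"] meas[of K]
    by (simp add: nn_integral_add)
  also have "\<dots> = (\<integral>\<^sup>+\<omega>. transition p q F (?Y \<omega>) \<partial>M)"
    by (simp only: trans)
  finally show ?thesis .
qed

text \<open>For \<open>c = 1\<close> this is the supermartingale inequality; for
  \<open>c < 1\<close> it yields geometric decay.\<close>

lemma nn_integral_state_le: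
  assumes "\<And>y m. transition p q F (y, m) \<le> c * F (y, m)"
  shows "(\<integral>\<^sup>+\<omega>. F (state \<xi> \<eta> x t \<omega>) \<partial>M) \<le> c ^ t * F (x, 0)"
proof (induction t)
  case 0
  show ?case by (simp add: state_0 emeasure_space_1)
next
  case (Suc t)
  have "(\<integral>\<^sup>+\<omega>. F (state \<xi> \<eta> x (Suc t) \<omega>) \<partial>M) \<le> (\<integral>\<^sup>+\<omega>. c * F (state \<xi> \<eta> x t \<omega>) \<partial>M)"
    unfolding nn_integral_state_Suc using assms by (intro nn_integral_mono) (metis surj_pair)
  also have "\<dots> = c * (\<integral>\<^sup>+\<omega>. F (state \<xi> \<eta> x t \<omega>) \<partial>M)"
    by (intro nn_integral_cmult measurable_compose[OF state_measurable]) simp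
  also have "\<dots> \<le> c * (c ^ t * F (x, 0))"
    by (intro mult_left_mono Suc) simp
  finally show ?case by (simp add: mult.assoc)
qed

lemma nn_integral_state_ge:
  assumes "\<And>y m. F (y, m) \<le> transition p q F (y, m)"
  shows "F (x, 0) \<le> (\<integral>\<^sup>+\<omega>. F (state \<xi> \<eta> x t \<omega>) \<partial>M)"
proof (induction t)
  case 0
  show ?case by (simp add: state_0 emeasure_space_1)
next
  case (Suc t)
  have "(\<integral>\<^sup>+\<omega>. F (state \<xi> \<eta> x t \<omega>) \<partial>M) \<le> (\<integral>\<^sup>+\<omega>. F (state \<xi> \<eta> x (Suc t) \<omega>) \<partial>M)"
    unfolding nn_integral_state_Suc using assms by (intro nn_integral_mono) (metis surj_pair)
  with Suc show ?case by (rule order_trans)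
qed

end

section \<open>Exponential weights of the coordinates under the jump laws\<close>

lemma nn_integral_powi_add:
  fixes a c :: real and \<pi> :: "'a::plus \<Rightarrow> int"
  assumes "0 < a" "0 \<le> c" and add: "\<And>u v. \<pi> (u + v) = \<pi> u + \<pi> v"
  shows "(\<integral>\<^sup>+k. ennreal (a powi \<pi> (y + k) * c) \<partial>measure_pmf P) =
    ennreal (a powi \<pi> y * c) * (\<integral>\<^sup>+k. ennreal (a powi \<pi> k) \<partial>P)"
proof -
  have "ennreal (a powi \<pi> (y + k) * c) = ennreal (a powi \<pi> y * c) * ennreal (a powi \<pi> k)" for k
    using assms by (simp add: add power_int_add ennreal_mult'[symmetric] mult_ac)
  then show ?thesis by (simp add: nn_integral_cmult)
qed

lemma powi_le_one: "0 < a \<Longrightarrow> a \<le> 1 \<Longrightarrow> 0 \<le> k \<Longrightarrow> a powi k \<le> (1::real)"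
  by (simp add: power_int_def power_le_one)

lemma mem_boundary_iff: "y \<in> quadrant_boundary \<longleftrightarrow> 0 \<le> fst y \<and> 0 \<le> snd y \<and> (fst y = 0 \<or> snd y = 0)"
  by (cases y) (auto simp: quadrant_boundary_def quadrant_def quadrant_interior_def)

lemma mem_interior_iff: "y \<in> quadrant_interior \<longleftrightarrow> 1 \<le> fst y \<and> 1 \<le> snd y"
  by (cases y) (auto simp: quadrant_interior_def)

lemma mem_quadrant_iff: "y \<in> quadrant \<longleftrightarrow> 0 \<le> fst y \<and> 0 \<le> snd y"
  by (cases y) (auto simp: quadrant_def)

context reflected_walk_data
begin

lemma set_pmf_p: "k \<in> set_pmf p \<Longrightarrow> -1 \<le> fst k \<and> -1 \<le> snd k"
  using p_support[of "fst k" "snd k"]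
  by (cases "fst k \<le> -2 \<or> snd k \<le> -2") (auto simp: set_pmf_iff)

lemma set_pmf_q: "k \<in> set_pmf q \<Longrightarrow> k \<in> quadrant"
  using q_support[of "fst k" "snd k"]
  by (cases "fst k \<le> -1 \<or> snd k \<le> -1") (auto simp: set_pmf_iff mem_quadrant_iff)

lemma interior_add_p: "y \<in> quadrant_interior \<Longrightarrow> k \<in> set_pmf p \<Longrightarrow> y + k \<in> quadrant"
  using set_pmf_p[of k] by (auto simp: mem_interior_iff mem_quadrant_iff)

lemma boundary_add_q: "y \<in> quadrant_boundary \<Longrightarrow> k \<in> set_pmf q \<Longrightarrow> y + k \<in> quadrant"
  using set_pmf_q[of k] by (auto simp: mem_boundary_iff mem_quadrant_iff)

text \<open>Jumps of \<open>q\<close> stay in the quadrant, where the exponent is nonnegative; the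
  weight is therefore bounded by 1 and integrable. Its strict positivity makes the mean
  positive.\<close>

lemma expectation_q_powi:
  fixes a :: real and \<pi> :: "int \<times> int \<Rightarrow> int"
  assumes a: "0 < a" "a \<le> 1" and nonneg: "\<And>y. y \<in> quadrant \<Longrightarrow> 0 \<le> \<pi> y"
  defines "A \<equiv> measure_pmf.expectation q (\<lambda>y. a powi \<pi> y)"
  shows "0 < A" "A \<le> 1" "(\<integral>\<^sup>+k. ennreal (a powi \<pi> k) \<partial>q) = ennreal A"
proof -
  have le: "AE k in q. a powi \<pi> k \<le> 1"
    using a nonneg set_pmf_q by (auto simp: AE_measure_pmf_iff intro: powi_le_one)
  have int: "integrable (measure_pmf q) (\<lambda>y. a powi \<pi> y)"
    by (rule measure_pmf.integrable_const_bound[where B = 1]) (use le a in auto)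
  show "A \<le> 1" unfolding A_def
    by (rule order_trans[OF integral_mono_AE[OF int _ le]]) simp_all
  show nn: "(\<integral>\<^sup>+k. ennreal (a powi \<pi> k) \<partial>q) = ennreal A"
    unfolding A_def by (rule nn_integral_eq_integral[OF int]) (use a in auto)
  have "(\<integral>\<^sup>+k. ennreal (a powi \<pi> k) \<partial>q) \<noteq> 0"
    using a by (subst nn_integral_0_iff_AE)
      (auto simp: AE_measure_pmf_iff not_le set_pmf_not_empty)
  then show "0 < A" unfolding nn by (simp add: ennreal_eq_0_iff not_le)
qed

text \<open>\<open>p_minus_one\<close> supplies a jump with first coordinate -1, which gives
  \<open>fst + 1\<close> an atom at 0. The extra point \<open>s\<close> serves the geometric decay
  in \<open>contacts_lower\<close>.\<close>

lemma alpha1_properties: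
  obtains s where "0 < alpha1 p" "alpha1 p < s" "s < 1"
    "(\<integral>\<^sup>+k. ennreal (alpha1 p powi fst k) \<partial>p) = 1" "(\<integral>\<^sup>+k. ennreal (s powi fst k) \<partial>p) < 1"
proof -
  obtain l where "pmf p (-1, l) \<noteq> 0" using p_minus_one by (metis less_irrefl mult_zero_left mult_zero_right)
  show ?thesis
  proof (rule pgf_root_of_drift[of p fst "(-1, l)" "alpha1 p"])
    show "-1 \<le> fst x" if "x \<in> set_pmf p" for x using set_pmf_p[OF that] by simp
    show "(-1, l) \<in> set_pmf p" by (simp add: set_pmf_iff) fact
    show "alpha1 p = (THE a. 0 < a \<and> a < 1 \<and> a = (\<Sum>\<^sub>\<infinity>x. pmf p x * a powi (fst x + 1)))"
      by (simp add: alpha1_def case_prod_unfold)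
    show "integrable p (\<lambda>x. real_of_int (fst x))"
      using p_summable_fst unfolding integrable_measure_pmf_iff_summable_on by (simp add: case_prod_unfold)
    show "0 < measure_pmf.expectation p (\<lambda>x. real_of_int (fst x))"
      using p_drift_fst unfolding expectation_measure_pmf_eq_infsum by (simp add: case_prod_unfold)
  qed (simp, rule that)
qed

lemma beta_m1_properties:
  obtains s where "0 < beta_m1 p" "beta_m1 p < s" "s < 1"
    "(\<integral>\<^sup>+k. ennreal (beta_m1 p powi snd k) \<partial>p) = 1" "(\<integral>\<^sup>+k. ennreal (s powi snd k) \<partial>p) < 1"
proof -
  obtain k where "pmf p (k, -1) \<noteq> 0" using p_minus_one by (metis less_irrefl mult_zero_left mult_zero_right)
  show ?thesis
  proof (rule pgf_root_of_drift[of p snd "(k, -1)" "beta_m1 p"])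
    show "-1 \<le> snd x" if "x \<in> set_pmf p" for x using set_pmf_p[OF that] by simp
    show "(k, -1) \<in> set_pmf p" by (simp add: set_pmf_iff) fact
    show "beta_m1 p = (THE a. 0 < a \<and> a < 1 \<and> a = (\<Sum>\<^sub>\<infinity>x. pmf p x * a powi (snd x + 1)))"
      by (simp add: beta_m1_def case_prod_unfold)
    show "integrable p (\<lambda>x. real_of_int (snd x))"
      using p_summable_snd unfolding integrable_measure_pmf_iff_summable_on by (simp add: case_prod_unfold)
    show "0 < measure_pmf.expectation p (\<lambda>x. real_of_int (snd x))"
      using p_drift_snd unfolding expectation_measure_pmf_eq_infsum by (simp add: case_prod_unfold)
  qed (simp, rule that)
qed

end

section \<open>Bounds on the contacts before a finite time\<close>

context reflected_walk
begin

lemma contacts_events: "{\<omega> \<in> space M. n < contacts \<xi> \<eta> x t \<omega>} \<in> events"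
proof -
  have "(\<lambda>\<omega>. snd (state \<xi> \<eta> x t \<omega>)) \<in> measurable M (count_space UNIV)"
    by (rule measurable_compose[OF state_measurable]) simp
  from measurable_sets[OF this, of "{n<..}"] show ?thesis
    by (simp add: state_def vimage_def Int_def conj_commute)
qed

lemma emeasure_contacts:
  "emeasure M {\<omega> \<in> space M. n < contacts \<xi> \<eta> x t \<omega>} =
    (\<integral>\<^sup>+\<omega>. of_bool (n < snd (state \<xi> \<eta> x t \<omega>)) \<partial>M)"
  by (subst nn_integral_indicator[OF contacts_events, symmetric])
    (auto intro!: nn_integral_cong simp: state_def indicator_def)

text \<open>The mean factor of a boundary step is offset by lowering the exponent of
  \<open>A\<close> and \<open>B\<close> with each counted contact. The weight is preserved in mean
  until the contact that lifts the counter above \<open>n\<close>, where it falls to 1.\<close>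

lemma contacts_upper:
  fixes a b :: real
  assumes a: "0 < a" "a \<le> 1" "(\<integral>\<^sup>+k. ennreal (a powi fst k) \<partial>p) = 1"
    and b: "0 < b" "b \<le> 1" "(\<integral>\<^sup>+k. ennreal (b powi snd k) \<partial>p) = 1"
  defines "A \<equiv> measure_pmf.expectation q (\<lambda>y. a powi fst y)"
    and "B \<equiv> measure_pmf.expectation q (\<lambda>y. b powi snd y)"
  shows "prob {\<omega> \<in> space M. n < contacts \<xi> \<eta> x t \<omega>} \<le> a powi fst x * A ^ n + b powi snd x * B ^ n"
proof -
  note A = expectation_q_powi[OF a(1,2), of fst, folded A_def]
  note B = expectation_q_powi[OF b(1,2), of snd, folded B_def]
  have A': "0 < A" "(\<integral>\<^sup>+k. ennreal (a powi fst k) \<partial>q) = ennreal A"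
    and B': "0 < B" "(\<integral>\<^sup>+k. ennreal (b powi snd k) \<partial>q) = ennreal B"
    using A B by (simp_all add: mem_quadrant_iff)
  define W where "W l y = a powi fst y * A ^ l + b powi snd y * B ^ l" for l :: nat and y
  have W_nonneg: "0 \<le> W l y" for l y using a b A' B' by (simp add: W_def)
  have split: "(\<integral>\<^sup>+k. ennreal (W l (y + k)) \<partial>measure_pmf P) =
      ennreal (a powi fst y * A ^ l) * (\<integral>\<^sup>+k. ennreal (a powi fst k) \<partial>P)
      + ennreal (b powi snd y * B ^ l) * (\<integral>\<^sup>+k. ennreal (b powi snd k) \<partial>P)" for P l y
  proof -
    have "(\<integral>\<^sup>+k. ennreal (a powi fst (y + k) * A ^ l) \<partial>measure_pmf P) =
        ennreal (a powi fst y * A ^ l) * (\<integral>\<^sup>+k. ennreal (a powi fst k) \<partial>P)"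
      by (rule nn_integral_powi_add[where \<pi> = fst]) (use a A' in auto)
    moreover have "(\<integral>\<^sup>+k. ennreal (b powi snd (y + k) * B ^ l) \<partial>measure_pmf P) =
        ennreal (b powi snd y * B ^ l) * (\<integral>\<^sup>+k. ennreal (b powi snd k) \<partial>P)"
      by (rule nn_integral_powi_add[where \<pi> = snd]) (use b B' in auto)
    ultimately show ?thesis
      unfolding W_def using a(1) b(1) A'(1) B'(1) by (simp add: nn_integral_add del: fst_add snd_add)
  qed
  have Wp: "(\<integral>\<^sup>+k. ennreal (W l (y + k)) \<partial>p) = ennreal (W l y)" for l y
    unfolding split unfolding a(3) b(3) W_def using a(1) b(1) A'(1) B'(1) by simp
  have Wq: "(\<integral>\<^sup>+k. ennreal (W l (y + k)) \<partial>q) = ennreal (W (Suc l) y)" for l y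
    unfolding split unfolding A'(2) B'(2) W_def using a(1) b(1) A'(1) B'(1)
    by (simp add: ennreal_mult'[symmetric] mult_ac)
  define G where "G = (\<lambda>(y, m). if m \<le> n then ennreal (W (n - m) y) else 1)"
  have G: "transition p q G (y, m) \<le> 1 * G (y, m)" for y m
  proof (cases "y \<in> quadrant_interior")
    case True
    then show ?thesis by (simp add: transition_def G_def Wp)
  next
    case False
    note ni = this
    show ?thesis
    proof (cases "y \<in> quadrant_boundary")
      case True
      \<comment> \<open>On an axis one exponent is 0, so one summand equals 1; this covers the
        replacement by 1 when \<open>m = n\<close>.\<close>
      have one: "1 \<le> W 0 y" using True a b by (auto simp: mem_boundary_iff W_def)
      consider "m < n" | "m = n" | "n < m" by linarith
      then show ?thesis
      proof cases
        case 1
        then have "n - m = Suc (n - Suc m)" by simp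
        with 1 True ni show ?thesis by (simp add: transition_def G_def Wq)
      qed (use True ni one in \<open>simp_all add: transition_def G_def\<close>)
    qed (use ni in \<open>simp add: transition_def\<close>)
  qed
  have "emeasure M {\<omega> \<in> space M. n < contacts \<xi> \<eta> x t \<omega>} \<le> (\<integral>\<^sup>+\<omega>. G (state \<xi> \<eta> x t \<omega>) \<partial>M)"
    unfolding emeasure_contacts by (intro nn_integral_mono) (simp add: G_def split_beta)
  also have "\<dots> \<le> 1 ^ t * G (x, 0)" by (rule nn_integral_state_le) (rule G)
  also have "\<dots> = ennreal (W n x)" by (simp add: G_def)
  finally show ?thesis using W_nonneg[of n x]
    by (simp add: emeasure_eq_measure W_def)
qed

text \<open>The submartingale \<open>H\<close> is compared with the contracting weight
  \<open>L\<close>, which bounds the part of \<open>H\<close> with few contacts. Both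
  \<open>r\<close> and \<open>C\<close> are chosen for a fixed \<open>n\<close>; only
  \<open>t\<close> varies.\<close>

lemma contacts_lower:
  fixes a s :: real and \<pi> :: "int \<times> int \<Rightarrow> int"
  assumes add: "\<And>u v. \<pi> (u + v) = \<pi> u + \<pi> v"
    and nonneg: "\<And>y. y \<in> quadrant \<Longrightarrow> 0 \<le> \<pi> y"
    and a: "0 < a" "a < s" "s < 1"
    and pa: "(\<integral>\<^sup>+k. ennreal (a powi \<pi> k) \<partial>p) = 1"
    and ps: "(\<integral>\<^sup>+k. ennreal (s powi \<pi> k) \<partial>p) < 1"
    and x: "x \<in> quadrant"
  defines "A \<equiv> measure_pmf.expectation q (\<lambda>y. a powi \<pi> y)"
  obtains r C where "0 < r" "r < 1"
    "\<And>t. a powi \<pi> x * A ^ n \<le> prob {\<omega> \<in> space M. n < contacts \<xi> \<eta> x t \<omega>} + C * r ^ t"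
proof -
  have "0 < s" using a by simp
  note pi_add = nn_integral_powi_add[where \<pi> = \<pi>, OF _ _ add]
  have A: "0 < A" "A \<le> 1" "(\<integral>\<^sup>+k. ennreal (a powi \<pi> k) \<partial>q) = ennreal A"
    using expectation_q_powi[of a \<pi>] a nonneg unfolding A_def by auto
  \<comment> \<open>The strict lower bound makes \<open>r\<close> positive, as the later division by
    \<open>r ^ n\<close> requires.\<close>
  obtain r' where r': "(\<integral>\<^sup>+k. ennreal (s powi \<pi> k) \<partial>p) < r'" "r' < 1"
    using dense[OF ps] by blast
  define r where "r = enn2real r'"
  have r'_eq: "r' = ennreal r" 
    unfolding r_def using order.strict_trans[OF r'(2) ennreal_one_less_top] by simp
  have "0 < ennreal r" using r'(1) unfolding r'_eq by (rule le_less_trans[OF zero_le])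
  have r: "0 < r" "r < 1" "(\<integral>\<^sup>+k. ennreal (s powi \<pi> k) \<partial>p) \<le> ennreal r"
    using \<open>0 < ennreal r\<close> r' by (auto simp: r'_eq)
  \<comment> \<open>Outside the quadrant the chain is frozen, so contraction by \<open>r\<close>
    forces the value 0 there; \<open>H\<close> is set to 0 as well to stay below
    \<open>L\<close>.\<close>
  define L where "L = (\<lambda>(y, m). if y \<in> quadrant then ennreal (s powi \<pi> y * r ^ m) else 0)"
  define H where "H = (\<lambda>(y, m). if y \<in> quadrant
    then if m \<le> n then ennreal (a powi \<pi> y * A ^ (n - m)) else 1 else 0)"
  have L: "transition p q L (y, m) \<le> ennreal r * L (y, m)" for y m
  proof -
    consider (int) "y \<in> quadrant_interior" | (bd) "y \<in> quadrant_boundary" "y \<notin> quadrant_interior"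
      | (out) "y \<notin> quadrant" "y \<notin> quadrant_boundary" "y \<notin> quadrant_interior"
      by (auto simp: quadrant_boundary_def)
    then show ?thesis
    proof cases
      case int
      have "(\<integral>\<^sup>+k. L (y + k, m) \<partial>p) = (\<integral>\<^sup>+k. ennreal (s powi \<pi> (y + k) * r ^ m) \<partial>p)"
        using interior_add_p[OF int] by (intro nn_integral_cong_AE) (simp add: AE_measure_pmf_iff L_def)
      also have "\<dots> \<le> ennreal (s powi \<pi> y * r ^ m) * ennreal r"
        using r \<open>0 < s\<close> by (subst pi_add) (auto intro: mult_left_mono)
      finally show ?thesis using int
        by (simp add: transition_def L_def mem_interior_iff mem_quadrant_iff mult.commute)
    next
      case bd
      \<comment> \<open>At a boundary step the counter provides the factor \<open>r\<close>, since
        jumps of \<open>q\<close> cannot increase \<open>s powi \<pi> y\<close>.\<close>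
      have "(\<integral>\<^sup>+k. L (y + k, Suc m) \<partial>q) \<le> (\<integral>\<^sup>+k. ennreal r * ennreal (s powi \<pi> y * r ^ m) \<partial>q)"
      proof (intro nn_integral_mono_AE, unfold AE_measure_pmf_iff, rule ballI)
        fix k assume k: "k \<in> set_pmf q"
        have "s powi \<pi> k \<le> 1"
          using nonneg set_pmf_q[OF k] a \<open>0 < s\<close> by (intro powi_le_one) auto
        then have "s powi \<pi> (y + k) * r ^ Suc m \<le> r * (s powi \<pi> y * r ^ m)"
          using \<open>0 < s\<close> r by (simp add: add power_int_add)
        then show "L (y + k, Suc m) \<le> ennreal r * ennreal (s powi \<pi> y * r ^ m)"
          using r \<open>0 < s\<close> by (auto simp: L_def ennreal_mult'[symmetric] intro: ennreal_leI)
      qed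
      then show ?thesis using bd
        by (simp add: transition_def L_def mem_boundary_iff mem_quadrant_iff)
    qed (simp add: transition_def L_def)
  qed
  have H: "H (y, m) \<le> transition p q H (y, m)" for y m
  proof -
    consider (int) "y \<in> quadrant_interior" | (bd) "y \<in> quadrant_boundary" "y \<notin> quadrant_interior"
      | (out) "y \<notin> quadrant"
      by (auto simp: quadrant_boundary_def)
    then show ?thesis
    proof cases
      case int
      have "(\<integral>\<^sup>+k. H (y + k, m) \<partial>p) =
          (\<integral>\<^sup>+k. (if m \<le> n then ennreal (a powi \<pi> (y + k) * A ^ (n - m)) else 1) \<partial>p)"
        using interior_add_p[OF int] by (intro nn_integral_cong_AE) (simp add: AE_measure_pmf_iff H_def)
      also have "\<dots> = (if m \<le> n then ennreal (a powi \<pi> y * A ^ (n - m)) else 1)"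
        using A a by (simp add: pi_add pa)
      finally show ?thesis using int
        by (simp add: transition_def H_def)
    next
      case bd
      have yQ: "y \<in> quadrant" using bd by (simp add: quadrant_boundary_def)
      have y1: "a powi \<pi> y \<le> 1" using nonneg[OF yQ] a by (intro powi_le_one) auto
      have "(\<integral>\<^sup>+k. H (y + k, Suc m) \<partial>q) =
          (\<integral>\<^sup>+k. (if Suc m \<le> n then ennreal (a powi \<pi> (y + k) * A ^ (n - Suc m)) else 1) \<partial>q)"
        using boundary_add_q[OF bd(1)] by (intro nn_integral_cong_AE) (simp add: AE_measure_pmf_iff H_def)
      also have "\<dots> = (if Suc m \<le> n then ennreal (a powi \<pi> y * A ^ (n - m)) else 1)"
      proof (cases "Suc m \<le> n")
        case True
        then have "n - m = Suc (n - Suc m)" by simp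
        then show ?thesis using True A a
          by (simp add: pi_add ennreal_mult'[symmetric] mult_ac)
      qed simp
      finally have "transition p q H (y, m) = \<dots>" using bd by (simp add: transition_def)
      \<comment> \<open>Equality holds except at \<open>m = n\<close>, where
        \<open>a powi \<pi> y\<close> is replaced by 1 and \<open>y1\<close> suffices.\<close>
      moreover have "H (y, m) \<le> \<dots>"
        using yQ y1 by (cases "m = n") (auto simp: H_def)
      ultimately show ?thesis by simp
    qed (simp add: H_def)
  qed
  \<comment> \<open>For \<open>m \<le> n\<close> the factor \<open>r ^ m / r ^ n\<close> is at least
    1, while \<open>a \<le> s\<close> and \<open>A \<le> 1\<close>; for \<open>m > n\<close> the
    value of \<open>H\<close> is at most 1.\<close>
  have HL: "H (y, m) \<le> of_bool (n < m) + ennreal (1 / r ^ n) * L (y, m)" for y m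
  proof (cases "y \<in> quadrant \<and> m \<le> n")
    case True
    have "a powi \<pi> y * A ^ (n - m) \<le> s powi \<pi> y * 1"
      using a A nonneg[of y] True
      by (intro mult_mono) (auto simp: power_int_def power_mono power_le_one)
    also have "\<dots> \<le> s powi \<pi> y * (1 / r ^ (n - m))"
      using \<open>0 < s\<close> r by (intro mult_left_mono) (auto simp: field_simps power_le_one)
    also have "\<dots> = 1 / r ^ n * (s powi \<pi> y * r ^ m)"
      using r True by (simp add: field_simps flip: power_add)
    finally show ?thesis using True r \<open>0 < s\<close>
      by (simp add: H_def L_def ennreal_mult'[symmetric] ennreal_leI)
  qed (auto simp: H_def)
  show ?thesis
  proof (rule that[OF r(1,2)])
    fix t
    have measb: "(\<lambda>\<omega>. of_bool (n < snd (state \<xi> \<eta> x t \<omega>)) :: ennreal) \<in> borel_measurable M"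
      by (rule measurable_compose[OF state_measurable]) simp
    have measL: "(\<lambda>\<omega>. L (state \<xi> \<eta> x t \<omega>)) \<in> borel_measurable M"
      by (rule measurable_compose[OF state_measurable]) simp
    have "ennreal (a powi \<pi> x * A ^ n) = H (x, 0)" using x by (simp add: H_def)
    also have "\<dots> \<le> (\<integral>\<^sup>+\<omega>. H (state \<xi> \<eta> x t \<omega>) \<partial>M)"
      by (rule nn_integral_state_ge) (rule H)
    also have "\<dots> \<le> (\<integral>\<^sup>+\<omega>. of_bool (n < snd (state \<xi> \<eta> x t \<omega>))
        + ennreal (1 / r ^ n) * L (state \<xi> \<eta> x t \<omega>) \<partial>M)"
      by (intro nn_integral_mono) (metis HL surj_pair snd_conv)
    also have "\<dots> = emeasure M {\<omega> \<in> space M. n < contacts \<xi> \<eta> x t \<omega>}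
        + ennreal (1 / r ^ n) * (\<integral>\<^sup>+\<omega>. L (state \<xi> \<eta> x t \<omega>) \<partial>M)"
      using measb measL by (simp add: nn_integral_add nn_integral_cmult emeasure_contacts)
    also have "\<dots> \<le> emeasure M {\<omega> \<in> space M. n < contacts \<xi> \<eta> x t \<omega>}
        + ennreal (1 / r ^ n) * (ennreal r ^ t * L (x, 0))"
      by (intro add_left_mono mult_left_mono nn_integral_state_le L) simp
    also have "\<dots> = ennreal (prob {\<omega> \<in> space M. n < contacts \<xi> \<eta> x t \<omega>} + s powi \<pi> x / r ^ n * r ^ t)"
      using x r \<open>0 < s\<close>
      by (simp add: L_def emeasure_eq_measure ennreal_power ennreal_mult'[symmetric] mult_ac)
    finally show "a powi \<pi> x * A ^ n \<le>
        prob {\<omega> \<in> space M. n < contacts \<xi> \<eta> x t \<omega>} + s powi \<pi> x / r ^ n * r ^ t"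
      using r \<open>0 < s\<close> by (subst (asm) ennreal_le_iff) auto
  qed
qed

section \<open>Letting time tend to infinity and combining the bounds\<close>

lemma boundary_contacts_gt_iff:
  "of_nat n < boundary_contacts \<xi> \<eta> x \<omega> \<longleftrightarrow> (\<exists>t. n < contacts \<xi> \<eta> x t \<omega>)"
proof -
  have "(\<Sum>m<t. indicator quadrant_boundary (walk \<xi> \<eta> x m \<omega>) :: ennreal) = of_nat (contacts \<xi> \<eta> x t \<omega>)" for t
    unfolding contacts_def of_nat_sum by (intro sum.cong) (auto simp: indicator_def)
  then show ?thesis
    \<comment> \<open>The series is the supremum of its partial sums, so a number strictly below it
      is already exceeded by one of them.\<close>
    unfolding boundary_contacts_def suminf_eq_SUP by (simp add: less_SUP_iff)
qed

text \<open>The counter grows with \<open>t\<close>, so the events increase and continuity from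
  below applies.\<close>

lemma tendsto_prob_contacts:
  "(\<lambda>t. prob {\<omega> \<in> space M. n < contacts \<xi> \<eta> x t \<omega>}) \<longlonglongrightarrow>
    prob {\<omega> \<in> space M. of_nat n < boundary_contacts \<xi> \<eta> x \<omega>}"
proof -
  have "contacts \<xi> \<eta> x t \<omega> \<le> contacts \<xi> \<eta> x t' \<omega>" if "t \<le> t'" for t t' \<omega>
    unfolding contacts_def using that by (intro sum_mono2) auto
  then have "incseq (\<lambda>t. {\<omega> \<in> space M. n < contacts \<xi> \<eta> x t \<omega>})"
    by (auto simp: incseq_def intro: less_le_trans)
  then have "(\<lambda>t. prob {\<omega> \<in> space M. n < contacts \<xi> \<eta> x t \<omega>}) \<longlonglongrightarrow>
      prob (\<Union>t. {\<omega> \<in> space M. n < contacts \<xi> \<eta> x t \<omega>})"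
    by (intro finite_Lim_measure_incseq) (simp_all add: image_subset_iff contacts_events)
  moreover have "(\<Union>t. {\<omega> \<in> space M. n < contacts \<xi> \<eta> x t \<omega>}) =
      {\<omega> \<in> space M. of_nat n < boundary_contacts \<xi> \<eta> x \<omega>}"
    by (auto simp: boundary_contacts_gt_iff)
  ultimately show ?thesis by simp
qed

text \<open>With \<open>n\<close> fixed the error \<open>C * r ^ t\<close> vanishes as
  \<open>t\<close> grows, even though \<open>C\<close> may depend on \<open>n\<close>.\<close>

lemma boundary_contacts_lower:
  fixes a s :: real and \<pi> :: "int \<times> int \<Rightarrow> int"
  assumes "\<And>u v. \<pi> (u + v) = \<pi> u + \<pi> v"
    and "\<And>y. y \<in> quadrant \<Longrightarrow> 0 \<le> \<pi> y"
    and "0 < a" "a < s" "s < 1"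
    and "(\<integral>\<^sup>+k. ennreal (a powi \<pi> k) \<partial>p) = 1" "(\<integral>\<^sup>+k. ennreal (s powi \<pi> k) \<partial>p) < 1"
    and "x \<in> quadrant"
  shows "a powi \<pi> x * (measure_pmf.expectation q (\<lambda>y. a powi \<pi> y)) ^ n
    \<le> prob {\<omega> \<in> space M. of_nat n < boundary_contacts \<xi> \<eta> x \<omega>}"
proof (rule contacts_lower[OF assms, of n])
  fix r C :: real
  assume r: "0 < r" "r < 1" and le: "\<And>t. a powi \<pi> x * (measure_pmf.expectation q (\<lambda>y. a powi \<pi> y)) ^ n
    \<le> prob {\<omega> \<in> space M. n < contacts \<xi> \<eta> x t \<omega>} + C * r ^ t"
  have "(\<lambda>t. prob {\<omega> \<in> space M. n < contacts \<xi> \<eta> x t \<omega>} + C * r ^ t) \<longlonglongrightarrow>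
      prob {\<omega> \<in> space M. of_nat n < boundary_contacts \<xi> \<eta> x \<omega>} + C * 0"
    using r by (intro tendsto_intros tendsto_prob_contacts LIMSEQ_power_zero) simp
  from LIMSEQ_le_const[OF this] le show ?thesis by auto
qed

end

theorem proposition3:
  fixes M :: "'w measure" and p q :: "(int \<times> int) pmf"
    and \<xi> \<eta> :: "nat \<Rightarrow> 'w \<Rightarrow> int \<times> int" and i j :: nat
  assumes "reflected_walk M p q \<xi> \<eta>"
  shows "(\<lambda>n. measure M {\<omega> \<in> space M. boundary_contacts \<xi> \<eta> (int i, int j) \<omega> > of_nat n}) \<asymp>
         (\<lambda>n. alpha1 p ^ i * (measure_pmf.expectation q (\<lambda>y. alpha1 p powi fst y)) ^ n
            + beta_m1 p ^ j * (measure_pmf.expectation q (\<lambda>y. beta_m1 p powi snd y)) ^ n)"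
proof -
  interpret reflected_walk M p q \<xi> \<eta> by fact
  obtain s where a: "0 < alpha1 p" "alpha1 p < s" "s < 1"
    "(\<integral>\<^sup>+k. ennreal (alpha1 p powi fst k) \<partial>p) = 1" "(\<integral>\<^sup>+k. ennreal (s powi fst k) \<partial>p) < 1"
    by (rule alpha1_properties)
  obtain s' where b: "0 < beta_m1 p" "beta_m1 p < s'" "s' < 1"
    "(\<integral>\<^sup>+k. ennreal (beta_m1 p powi snd k) \<partial>p) = 1" "(\<integral>\<^sup>+k. ennreal (s' powi snd k) \<partial>p) < 1"
    by (rule beta_m1_properties)
  define x where "x = (int i, int j)"
  define A where "A = measure_pmf.expectation q (\<lambda>y. alpha1 p powi fst y)"
  define B where "B = measure_pmf.expectation q (\<lambda>y. beta_m1 p powi snd y)"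
  define u where "u n = prob {\<omega> \<in> space M. of_nat n < boundary_contacts \<xi> \<eta> x \<omega>}" for n
  define w where "w n = alpha1 p ^ i * A ^ n + beta_m1 p ^ j * B ^ n" for n
  have a1: "alpha1 p \<le> 1" and b1: "beta_m1 p \<le> 1" using a b by simp_all
  have xQ: "x \<in> quadrant" by (simp add: x_def mem_quadrant_iff)
  have AB: "0 < A" "0 < B"
    unfolding A_def B_def using a1 b1 a(1) b(1)
    by (auto intro!: expectation_q_powi simp: mem_quadrant_iff)
  have w_pos: "0 < w n" for n unfolding w_def using AB a(1) b(1) by (simp add: add_pos_pos)
  have lowA: "alpha1 p ^ i * A ^ n \<le> u n" for n
    using boundary_contacts_lower[of fst, OF _ _ a xQ, of n]
    by (simp add: A_def u_def x_def mem_quadrant_iff)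
  have lowB: "beta_m1 p ^ j * B ^ n \<le> u n" for n
    using boundary_contacts_lower[of snd, OF _ _ b xQ, of n]
    by (simp add: B_def u_def x_def mem_quadrant_iff)
  \<comment> \<open>The finite-time bound is uniform in \<open>t\<close> and survives the
    limit.\<close>
  have up: "u n \<le> w n" for n
    unfolding u_def
    by (rule LIMSEQ_le_const2[OF tendsto_prob_contacts])
      (use contacts_upper[OF a(1) a1 a(4) b(1) b1 b(4), of n x] in
        \<open>auto simp: w_def A_def B_def x_def\<close>)
  \<comment> \<open>Adding the two lower bounds gives \<open>w n \<le> 2 * u n\<close>, whence the
    constant 1/2. The estimates hold for every \<open>n\<close>.\<close>
  have "1/2 \<le> u n / w n \<and> u n / w n \<le> 1" for n
    using lowA[of n] lowB[of n] up[of n] w_pos[of n] by (simp add: w_def field_simps)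
  then have "u \<asymp> w" unfolding seq_asymp_def
    by (intro exI[of _ "1/2"] exI[of _ 1]) auto
  then show ?thesis by (simp add: u_def[abs_def] w_def[abs_def] x_def A_def B_def)
qed

end
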